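(* Let $s>t\ge1$ and $r\ge2$ be integers, and set $d=\frac{2s-t-1}{s-t+1}$. If $d$ is an integer and $d\mid r$, then, as $n\to\infty$, $$L_{(s,t)}(n,r)=\Theta\left(n^{r/d}\right)=\Theta\left(n^{(s-t+1)r/(2s-t-1)}\right).$$
   Context: An $r$-uniform hypergraph ($r$-graph) is a family (without repeated members) of $r$-element subsets, called edges, of a finite vertex set. For integers $s\ge t\ge1$, an $r$-graph is called locally $(s,t)$-thin if, among any $s$ distinct edges, at least $t$ of them contain a vertex that belongs to none of the other $s-1$ edges. $L_{(s,t)}(n,r)$ denotes the maximum number of edges in a locally $(s,t)$-thin $r$-graph on $n$ vertices. The parameters $s,t,r$ are fixed, and the constants implied by $\Theta$ may depend on $s,t,r$ only. *)

theory Defs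
  imports Complex_Main "HOL-Library.Landau_Symbols"
begin

definition uniform_hypergraph :: "nat \<Rightarrow> 'a set \<Rightarrow> 'a set set \<Rightarrow> bool" where
  "uniform_hypergraph r V E \<longleftrightarrow> finite V \<and> (\<forall>e\<in>E. e \<subseteq> V \<and> card e = r)"

definition has_own_vertex :: "'a set set \<Rightarrow> 'a set \<Rightarrow> bool" where
  "has_own_vertex S e \<longleftrightarrow> (\<exists>v\<in>e. \<forall>f\<in>S - {e}. v \<notin> f)"

text \<open>
  For \<open>s > 0\<close> the condition \<open>card S = s\<close> forces \<open>S\<close> to be finite, and
  a family with fewer than \<open>s\<close> edges is vacuously locally \<open>(s,t)\<close>-thin.
\<close>

definition locally_thin :: "nat \<Rightarrow> nat \<Rightarrow> 'a set set \<Rightarrow> bool" where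
  "locally_thin s t E \<longleftrightarrow>
     (\<forall>S\<subseteq>E. card S = s \<longrightarrow> card {e \<in> S. has_own_vertex S e} \<ge> t)"

text \<open>
  The standard vertex set \<open>{..<n}\<close> stands for an arbitrary \<open>n\<close>-element set; by the lemmas below
  the maximum is over a finite nonempty set and the choice of vertex set is immaterial.
\<close>

definition max_thin :: "nat \<Rightarrow> nat \<Rightarrow> nat \<Rightarrow> nat \<Rightarrow> nat" where
  "max_thin s t n r =
     Max {card E |E. uniform_hypergraph r {..<n} E \<and> locally_thin s t E}"

lemma finite_thin_sizes:
  fixes V :: "'a set"
  assumes "finite V"
  shows "finite {card E |E. uniform_hypergraph r V E \<and> locally_thin s t E}"
proof (rule finite_subset)
  show "{card E |E. uniform_hypergraph r V E \<and> locally_thin s t E} \<subseteq> card ` Pow (Pow V)"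
    by (auto simp: uniform_hypergraph_def)
  show "finite (card ` Pow (Pow V))"
    using assms by simp
qed

lemma thin_sizes_nonempty:
  fixes V :: "'a set"
  assumes "finite V" and "s > 0"
  shows "{card E |E. uniform_hypergraph r V E \<and> locally_thin s t E} \<noteq> {}"
proof -
  have "uniform_hypergraph r V {} \<and> locally_thin s t ({} :: 'a set set)"
    using assms by (auto simp: uniform_hypergraph_def locally_thin_def)
  then show ?thesis by blast
qed

lemma thin_transfer:
  fixes f :: "'a \<Rightarrow> 'b"
  assumes f: "inj_on f V" and U: "uniform_hypergraph r V E" and L: "locally_thin s t E"
  shows "uniform_hypergraph r (f ` V) ((`) f ` E)" "locally_thin s t ((`) f ` E)"
    "card ((`) f ` E) = card E"
proof -
  have EV: "\<And>e. e \<in> E \<Longrightarrow> e \<subseteq> V" using U by (auto simp: uniform_hypergraph_def)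
  have inj: "inj_on ((`) f) E"
    using f EV by (meson inj_onI inj_on_image_eq_iff)
  show "card ((`) f ` E) = card E" by (rule card_image[OF inj])
  show "uniform_hypergraph r (f ` V) ((`) f ` E)"
    using U f unfolding uniform_hypergraph_def
    by (auto simp: card_image inj_on_subset)
  have own: "has_own_vertex ((`) f ` S) (f ` e)"
    if S: "S \<subseteq> E" and e: "e \<in> S" and h: "has_own_vertex S e" for S e
  proof -
    obtain v where v: "v \<in> e" "\<forall>g\<in>S - {e}. v \<notin> g"
      using h by (auto simp: has_own_vertex_def)
    have "f v \<notin> f ` g" if "g \<in> S" "f ` g \<noteq> f ` e" for g
    proof -
      have "v \<notin> g" using v(2) that by blast
      moreover have "g \<subseteq> V" "v \<in> V" using EV S e v(1) that by blast+
      ultimately show ?thesis using f by (simp add: inj_on_image_mem_iff)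
    qed
    then have "\<forall>h\<in>(`) f ` S - {f ` e}. f v \<notin> h" by blast
    moreover have "f v \<in> f ` e" using v(1) by blast
    ultimately show ?thesis unfolding has_own_vertex_def by blast
  qed
  show "locally_thin s t ((`) f ` E)"
    unfolding locally_thin_def
  proof (intro allI impI)
    fix T assume T: "T \<subseteq> (`) f ` E" and c: "card T = s"
    obtain S where S: "S \<subseteq> E" "T = (`) f ` S" using T by (auto simp: subset_image_iff)
    have injS: "inj_on ((`) f) S" using inj S(1) by (rule inj_on_subset)
    have "finite V" using U by (simp add: uniform_hypergraph_def)
    then have "finite E" using EV by (meson PowI finite_Pow_iff finite_subset subsetI)
    then have finT: "finite T" using S finite_subset by blast
    have "card S = s" using c S(2) card_image[OF injS] by simp
    then have "t \<le> card {e \<in> S. has_own_vertex S e}"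
      using L S(1) by (auto simp: locally_thin_def)
    also have "\<dots> = card ((`) f ` {e \<in> S. has_own_vertex S e})"
      by (rule card_image[symmetric]) (rule inj_on_subset[OF injS], blast)
    also have "\<dots> \<le> card {e \<in> T. has_own_vertex T e}"
      by (rule card_mono) (use finT own S in auto)
    finally show "t \<le> card {e \<in> T. has_own_vertex T e}" .
  qed
qed

lemma max_thin_eq_any_vertex_set:
  fixes V :: "'a set"
  assumes "finite V" and "card V = n"
  shows "max_thin s t n r = Max {card E |E. uniform_hypergraph r V E \<and> locally_thin s t E}"
proof -
  obtain f where f: "bij_betw f V {..<n}"
    using assms by (metis card_lessThan finite_lessThan finite_same_card_bij)
  obtain g where g: "bij_betw g {..<n} V"
    using f bij_betw_inv by blast
  have "{card E |E. uniform_hypergraph r {..<n} E \<and> locally_thin s t E} =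
        {card E |E. uniform_hypergraph r V E \<and> locally_thin s t E}" (is "?A = ?B")
  proof
    show "?A \<subseteq> ?B"
      using thin_transfer[where f = g and V = "{..<n}"] g
      by (auto simp: bij_betw_def) metis
    show "?B \<subseteq> ?A"
      using thin_transfer[where f = f and V = V] f
      by (auto simp: bij_betw_def) metis
  qed
  then show ?thesis by (simp add: max_thin_def)
qed

end

theory Submission
  imports Defs
begin

text \<open>
  Put \<open>k = s - t + 1\<close> and \<open>r = d q\<close>, so that \<open>s + k = d k + 2\<close>. A set of \<open>s\<close> edges is
  forbidden iff at least \<open>k\<close> of them are covered by the others.

  Upper bound: after the deletion of at most \<open>n choose q\<close> edges, every \<open>q\<close>-subset of an edge
  lies in a second edge. Split an edge into \<open>d\<close> blocks of size \<open>q\<close> and cover each by another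
  edge; then cover one of the new edges, which already has a covered block, by \<open>d - 1\<close> further
  edges, and so on. This covers \<open>k\<close> edges with at most \<open>2 + k (d - 1) = s\<close> edges in all.
  (If \<open>d = 1\<close>, then \<open>q = r\<close> and the bound is trivial.)

  Lower bound: by the deletion method there are \<open>r\<close>-graphs with of order \<open>n\<^sup>q\<close> edges in which
  any \<open>j\<close> edges span more than \<open>j r - (j - 1) q\<close> vertices, for \<open>j = s\<close> and \<open>j = k\<close>. If \<open>k\<close> edges
  \<open>A\<close> of an \<open>s\<close>-set \<open>S\<close> were covered, then each vertex of \<open>\<Union>A\<close> would lie in two edges of \<open>S\<close>, so
  \<open>card (\<Union>S) + card (\<Union>A)\<close> would be at most \<open>s r\<close>, whereas sparseness makes it larger than
  \<open>s r + k r - (s + k - 2) q = s r\<close>.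
\<close>

section \<open>Local thinness in terms of covered edges\<close>

lemma not_has_own_vertex_iff: "\<not> has_own_vertex S e \<longleftrightarrow> e \<subseteq> \<Union>(S - {e})"
  unfolding has_own_vertex_def by blast

text \<open>An edge of \<open>S\<close> either has an own vertex or is covered by the others, so the
  two counts add up to \<open>s\<close>; \<open>0 < s\<close> makes \<open>S\<close> finite.\<close>

lemma locally_thin_iff:
  assumes "0 < s" "t \<le> s"
  shows "locally_thin s t E \<longleftrightarrow>
    (\<forall>S\<subseteq>E. card S = s \<longrightarrow> card {e \<in> S. e \<subseteq> \<Union>(S - {e})} \<le> s - t)"
proof -
  have "t \<le> card {e \<in> S. has_own_vertex S e} \<longleftrightarrow> card {e \<in> S. e \<subseteq> \<Union>(S - {e})} \<le> s - t"
    if S: "card S = s" for S :: "'a set set"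
  proof -
    have fin: "finite S"
      using S assms by (simp add: card_ge_0_finite)
    have "card S = card ({e \<in> S. has_own_vertex S e} \<union> {e \<in> S. e \<subseteq> \<Union>(S - {e})})"
      by (rule arg_cong[where f = card]) (auto simp flip: not_has_own_vertex_iff)
    also have "\<dots> = card {e \<in> S. has_own_vertex S e} + card {e \<in> S. e \<subseteq> \<Union>(S - {e})}"
      by (rule card_Un_disjoint) (use fin in \<open>auto simp flip: not_has_own_vertex_iff\<close>)
    finally show ?thesis
      using S assms by linarith
  qed
  then show ?thesis
    unfolding locally_thin_def by blast
qed

section \<open>Upper bound\<close>

definition shadow :: "nat \<Rightarrow> 'a set set \<Rightarrow> 'a set set" where
  "shadow q E = {P. card P = q \<and> (\<exists>e\<in>E. P \<subseteq> e)}"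

definition no_private_subset :: "nat \<Rightarrow> 'a set set \<Rightarrow> bool" where
  "no_private_subset q F \<longleftrightarrow> (\<forall>e\<in>F. \<forall>P\<subseteq>e. card P = q \<longrightarrow> (\<exists>f\<in>F - {e}. P \<subseteq> f))"

lemma finite_shadow:
  assumes "finite E" "\<And>e. e \<in> E \<Longrightarrow> finite e"
  shows "finite (shadow q E)"
proof (rule finite_subset)
  show "shadow q E \<subseteq> Pow (\<Union>E)"
    unfolding shadow_def by blast
qed (use assms in auto)

text \<open>Deleting an edge with a private \<open>q\<close>-subset removes that subset from the shadow.\<close>

lemma ex_no_private_subset:
  assumes "finite E" "\<And>e. e \<in> E \<Longrightarrow> finite e"
  shows "\<exists>F\<subseteq>E. no_private_subset q F \<and>
    card E + card (shadow q F) \<le> card F + card (shadow q E)"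
  using assms
proof (induction E rule: finite_psubset_induct)
  case (psubset E)
  show ?case
  proof (cases "no_private_subset q E")
    case True
    then show ?thesis by (intro exI[of _ E]) simp
  next
    case False
    then obtain e P where e: "e \<in> E" "P \<subseteq> e" "card P = q" "\<forall>f\<in>E - {e}. \<not> P \<subseteq> f"
      unfolding no_private_subset_def by metis
    have "E - {e} \<subset> E"
      using e by blast
    then have "\<exists>F\<subseteq>E - {e}. no_private_subset q F \<and>
        card (E - {e}) + card (shadow q F) \<le> card F + card (shadow q (E - {e}))"
      by (rule psubset.IH) (use psubset.prems in simp)
    then obtain F where F: "F \<subseteq> E - {e}" "no_private_subset q F"
        "card (E - {e}) + card (shadow q F) \<le> card F + card (shadow q (E - {e}))"
      by blast
    have "P \<in> shadow q E"
      unfolding shadow_def using e(1-3) by blast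
    moreover have "P \<notin> shadow q (E - {e})"
      unfolding shadow_def using e(4) by blast
    moreover have "shadow q (E - {e}) \<subseteq> shadow q E"
      by (auto simp: shadow_def)
    ultimately have "shadow q (E - {e}) \<subset> shadow q E"
      by blast
    then have "card (shadow q (E - {e})) < card (shadow q E)"
      using finite_shadow[OF psubset.hyps psubset.prems] by (rule psubset_card_mono[rotated])
    moreover have "card E = Suc (card (E - {e}))"
      by (rule card.remove[OF psubset.hyps e(1)])
    \<comment> \<open>Subtraction-free form of: the number of deleted edges is at most the loss in
      the shadow.\<close>
    ultimately have "card E + card (shadow q F) \<le> card F + card (shadow q E)"
      using F(3) by linarith
    moreover have "F \<subseteq> E"
      using F(1) by blast
    ultimately show ?thesis
      using F(2) by (intro exI[of _ F]) simp
  qed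
qed

text \<open>Cut \<open>X\<close> into \<open>j\<close> blocks of size \<open>q\<close>; no block is
  private to \<open>e\<close>, so each lies in another edge. That these edges share a
  \<open>q\<close>-set with \<open>e\<close> is recorded because it makes them cheaper to cover
  later.\<close>

lemma cover_by_overlaps:
  assumes F: "no_private_subset q F" "e \<in> F" and fin: "finite e"
    and X: "X \<subseteq> e" "card X = j * q"
  shows "\<exists>G\<subseteq>F - {e}. finite G \<and> card G \<le> j \<and> X \<subseteq> \<Union>G \<and> (\<forall>f\<in>G. \<exists>P\<subseteq>e \<inter> f. card P = q)"
  using X
proof (induction j arbitrary: X)
  case 0
  then have "X = {}"
    using finite_subset[OF 0(1) fin] by simp
  then show ?case by (intro exI[of _ "{}"]) simp
next
  case (Suc j)
  then have "q \<le> card X"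
    by simp
  then obtain P where P: "P \<subseteq> X" "card P = q" "finite P"
    by (rule obtain_subset_with_card_n)
  then have "card (X - P) = j * q"
    using Suc.prems by (simp add: card_Diff_subset)
  then obtain G where G: "G \<subseteq> F - {e}" "finite G" "card G \<le> j" "X - P \<subseteq> \<Union>G"
    "\<forall>f\<in>G. \<exists>P\<subseteq>e \<inter> f. card P = q"
    using Suc.IH[of "X - P"] Suc.prems by blast
  obtain f where f: "f \<in> F - {e}" "P \<subseteq> f"
    using F P(1,2) Suc.prems(1) unfolding no_private_subset_def by (metis order_trans)
  have "P \<subseteq> e \<inter> f"
    using P f Suc.prems by blast
  moreover have "card (insert f G) \<le> Suc j"
    using G by (simp add: card_insert_if)
  moreover have "X \<subseteq> \<Union>(insert f G)"
    using G(4) f(2) by blast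
  moreover have "insert f G \<subseteq> F - {e}" "finite (insert f G)"
    using G(1,2) f(1) by simp_all
  ultimately show ?case
    using G(5) P(2) by (intro exI[of _ "insert f G"]) blast
qed

text \<open>
  Covering an edge costs \<open>c + 1\<close> further edges in general, but only \<open>c\<close> if it
  already meets a chosen edge in \<open>q\<close> vertices; the last clause of the invariant makes this
  saving available at every step but those where all chosen edges are already covered.
\<close>

lemma ex_covered_edges:
  assumes F: "no_private_subset q F" and unif: "\<And>e. e \<in> F \<Longrightarrow> finite e \<and> card e = Suc c * q"
    and c: "1 \<le> c" and m: "m \<le> card F"
  shows "\<exists>A S. A \<subseteq> S \<and> S \<subseteq> F \<and> finite S \<and> card A = m \<and> card S \<le> 2 + m * c \<and>
    (\<forall>e\<in>A. e \<subseteq> \<Union>(S - {e})) \<and> (\<forall>e\<in>S - A. \<exists>g\<in>S - {e}. \<exists>P\<subseteq>e \<inter> g. card P = q)"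
  using m
proof (induction m)
  case 0
  then show ?case by (intro exI[of _ "{}"]) auto
next
  case (Suc m)
  have "m \<le> card F"
    using Suc.prems by simp
  from Suc.IH[OF this] obtain A S where AS: "A \<subseteq> S" "S \<subseteq> F" "finite S" "card A = m"
    "card S \<le> 2 + m * c" "\<forall>e\<in>A. e \<subseteq> \<Union>(S - {e})"
    "\<forall>e\<in>S - A. \<exists>g\<in>S - {e}. \<exists>P\<subseteq>e \<inter> g. card P = q"
    by (elim exE conjE)
  have finA: "finite A"
    by (rule finite_subset[OF AS(1,3)])
  have "\<exists>e\<in>F - A. \<exists>G\<subseteq>F - {e}. finite G \<and> e \<subseteq> \<Union>(S \<union> G - {e}) \<and>
      (\<forall>f\<in>G. \<exists>P\<subseteq>e \<inter> f. card P = q) \<and> card (insert e (S \<union> G)) \<le> 2 + Suc m * c"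
  proof (cases "S = A")
    case True
    then have "card S < card F"
      using AS Suc.prems by simp
    then obtain e where e: "e \<in> F" "e \<notin> S"
      using card_mono[OF AS(3), of F] by (meson not_le subsetI)
    obtain G where G: "G \<subseteq> F - {e}" "finite G" "card G \<le> Suc c" "e \<subseteq> \<Union>G"
      "\<forall>f\<in>G. \<exists>P\<subseteq>e \<inter> f. card P = q"
      using cover_by_overlaps[OF F e(1), of e "Suc c"] unif[OF e(1)] by blast
    have "card (insert e (S \<union> G)) \<le> Suc (card S + card G)"
      using AS(3) G(2) card_Un_le[of S G] by (simp add: card_insert_if)
    \<comment> \<open>As \<open>S = A\<close> has just \<open>m\<close> edges, there is room for
      \<open>e\<close> and a full cover by \<open>Suc c\<close> edges; the next estimate rests on
      \<open>1 \<le> c\<close>.\<close>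
    also have "\<dots> \<le> Suc (m + Suc c)"
      using G True AS by simp
    also have "\<dots> \<le> 2 + Suc m * c"
      using c by simp
    finally have "card (insert e (S \<union> G)) \<le> 2 + Suc m * c" .
    moreover have "e \<subseteq> \<Union>(S \<union> G - {e})"
      using G(1,4) by blast
    ultimately show ?thesis
      using e G True by (intro bexI[of _ e] exI[of _ G] conjI) auto
  next
    case False
    then obtain e where e: "e \<in> S" "e \<notin> A"
      using AS by blast
    then obtain g P where g: "g \<in> S" "g \<noteq> e" "P \<subseteq> e \<inter> g" "card P = q"
      using AS(7) by (metis DiffE DiffI insertI1)
    have eF: "e \<in> F"
      using e AS by blast
    have "finite P"
      using g(3) unif[OF eF] by (meson finite_subset le_inf_iff)
    \<comment> \<open>\<open>e\<close> is already in \<open>S\<close> and \<open>g\<close> covers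
      the block \<open>P\<close>, so at most \<open>c\<close> new edges are needed.\<close>
    then have "card (e - P) = c * q"
      using g(3,4) unif[OF eF] by (simp add: card_Diff_subset)
    then obtain G where G: "G \<subseteq> F - {e}" "finite G" "card G \<le> c" "e - P \<subseteq> \<Union>G"
      "\<forall>f\<in>G. \<exists>P\<subseteq>e \<inter> f. card P = q"
      using cover_by_overlaps[OF F eF, of "e - P" c] unif[OF eF] by blast
    have "card (insert e (S \<union> G)) \<le> card S + card G"
      using e by (simp add: insert_absorb card_Un_le)
    also have "\<dots> \<le> 2 + Suc m * c"
      using G AS by simp
    finally have "card (insert e (S \<union> G)) \<le> 2 + Suc m * c" .
    moreover have "e \<subseteq> \<Union>(S \<union> G - {e})"
    proof -
      have "P \<subseteq> \<Union>(S - {e})"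
        using g(1-3) by blast
      then show ?thesis
        using G(1,4) by blast
    qed
    ultimately show ?thesis
      using e(2) eF G by (intro bexI[of _ e] exI[of _ G] conjI) auto
  qed
  then obtain e G where e: "e \<in> F" "e \<notin> A" and G: "G \<subseteq> F - {e}" "finite G"
      "e \<subseteq> \<Union>(S \<union> G - {e})" "\<forall>f\<in>G. \<exists>P\<subseteq>e \<inter> f. card P = q"
      "card (insert e (S \<union> G)) \<le> 2 + Suc m * c"
    by blast
  have "card (insert e A) = Suc m"
    using e AS(4) finA by simp
  moreover have "f \<subseteq> \<Union>(insert e (S \<union> G) - {f})" if "f \<in> insert e A" for f
  proof -
    have "f \<subseteq> \<Union>(S \<union> G - {f})"
      using that AS(6) G(3) by (cases "f = e") blast+
    then show ?thesis
      by blast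
  qed
  \<comment> \<open>A new edge from \<open>G\<close> shares a \<open>q\<close>-set with
    \<open>e\<close>, which preserves the invariant.\<close>
  moreover have "\<exists>g\<in>insert e (S \<union> G) - {f}. \<exists>P\<subseteq>f \<inter> g. card P = q"
    if "f \<in> insert e (S \<union> G) - insert e A" for f
  proof (cases "f \<in> S")
    case True
    then have "\<exists>g\<in>S - {f}. \<exists>P\<subseteq>f \<inter> g. card P = q"
      using AS(7) that by simp
    then show ?thesis
      by blast
  next
    case False
    then have "f \<in> G" "f \<noteq> e"
      using that by auto
    then obtain P where "P \<subseteq> e \<inter> f" "card P = q"
      using G(4) by blast
    then show ?thesis
      using \<open>f \<noteq> e\<close> by (intro bexI[of _ e] exI[of _ P]) auto
  qed
  moreover have "insert e A \<subseteq> insert e (S \<union> G)" "insert e (S \<union> G) \<subseteq> F" "finite (insert e (S \<union> G))"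
    using AS(1-3) e(1) G(1,2) by blast+
  ultimately show ?case
    using G(5) by (intro exI[of _ "insert e A"] exI[of _ "insert e (S \<union> G)"] conjI ballI)
qed

text \<open>If the bound failed, deletion would leave at least \<open>s\<close> edges without
  private \<open>q\<close>-subsets; among these, \<open>s - t + 1\<close> edges can be covered
  within a set of at most \<open>2 + (s - t + 1) * c = s\<close> edges, one covered edge too
  many.\<close>

lemma locally_thin_card_le:
  fixes V :: "'a set"
  assumes E: "uniform_hypergraph (Suc c * q) V E" "locally_thin s t E"
    and t: "t \<le> s" and s: "s = 2 + (s - t + 1) * c" and c: "1 \<le> c"
  shows "card E \<le> (card V choose q) + s"
proof (rule ccontr)
  assume large: "\<not> ?thesis"
  have V: "finite V" and eV: "\<And>e. e \<in> E \<Longrightarrow> e \<subseteq> V \<and> card e = Suc c * q"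
    using E unfolding uniform_hypergraph_def by auto
  have fe: "\<And>e. e \<in> E \<Longrightarrow> finite e"
    using V eV by (meson finite_subset)
  have fE: "finite E"
    using large by (metis card.infinite le0)
  obtain F where F: "F \<subseteq> E" "no_private_subset q F"
      "card E + card (shadow q F) \<le> card F + card (shadow q E)"
    using ex_no_private_subset[OF fE fe] by metis
  have "card (shadow q E) \<le> card {P. P \<subseteq> V \<and> card P = q}"
  proof (rule card_mono)
    show "shadow q E \<subseteq> {P. P \<subseteq> V \<and> card P = q}"
      unfolding shadow_def using eV by blast
  qed (use V in simp)
  also have "\<dots> = card V choose q"
    using V by (rule n_subsets)
  finally have "s \<le> card F"
    using F large by linarith
  moreover have "s - t + 1 \<le> s"
  proof -
    have "s - t + 1 \<le> (s - t + 1) * c"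
      using mult_le_mono2[OF c, of "s - t + 1"] by (simp only: mult_1_right)
    also have "\<dots> \<le> 2 + (s - t + 1) * c"
      by (rule le_add2)
    also have "\<dots> = s"
      using s by (rule sym)
    finally show ?thesis .
  qed
  ultimately have k: "s - t + 1 \<le> card F"
    by linarith
  have unifF: "\<And>e. e \<in> F \<Longrightarrow> finite e \<and> card e = Suc c * q"
    using F(1) fe eV by blast
  obtain A S where AS: "A \<subseteq> S" "S \<subseteq> F" "card A = s - t + 1"
      "card S \<le> 2 + (s - t + 1) * c" "\<forall>e\<in>A. e \<subseteq> \<Union>(S - {e})"
    using ex_covered_edges[OF F(2) _ c k] unifF by metis
  \<comment> \<open>Padding to exactly \<open>s\<close> edges of \<open>E\<close> keeps covered
    edges covered.\<close>
  have "s \<le> card E"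
    using large by simp
  then obtain T where T: "S \<subseteq> T" "T \<subseteq> E" "card T = s"
    using exists_subset_between[of S s E] AS(2,4) F(1) fE s by (metis subset_trans)
  have "card A \<le> card {e \<in> T. e \<subseteq> \<Union>(T - {e})}"
  proof (rule card_mono)
    show "finite {e \<in> T. e \<subseteq> \<Union>(T - {e})}"
      using finite_subset[OF T(2) fE] by simp
    show "A \<subseteq> {e \<in> T. e \<subseteq> \<Union>(T - {e})}"
    proof
      fix e assume e: "e \<in> A"
      then have "e \<subseteq> \<Union>(S - {e})" "e \<in> T"
        using AS(1,5) T(1) by blast+
      moreover have "\<Union>(S - {e}) \<subseteq> \<Union>(T - {e})"
        using T(1) by blast
      ultimately show "e \<in> {e \<in> T. e \<subseteq> \<Union>(T - {e})}"
        by blast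
    qed
  qed
  moreover have "card {e \<in> T. e \<subseteq> \<Union>(T - {e})} \<le> s - t"
  proof -
    have "0 < s"
      using s by linarith
    then show ?thesis
      using E(2) T(2,3) unfolding locally_thin_iff[OF \<open>0 < s\<close> t] by blast
  qed
  ultimately show False
    using AS(3) by simp
qed

section \<open>Lower bound\<close>

text \<open>Double counting: \<open>card S * r\<close> is the sum of the degrees in
  \<open>S\<close>, which are at least 1 on \<open>\<Union>S\<close> and at least 2 on
  \<open>\<Union>A\<close>.\<close>

lemma card_Union_covered:
  assumes "finite S" "A \<subseteq> S" "\<And>e. e \<in> S \<Longrightarrow> finite e \<and> card e = r"
    and "\<And>e. e \<in> A \<Longrightarrow> e \<subseteq> \<Union>(S - {e})"
  shows "card (\<Union>S) + card (\<Union>A) \<le> card S * r"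
proof -
  have fin: "finite (\<Union>S)"
    using assms by auto
  have "card (\<Union>S) + card (\<Union>A) = (\<Sum>v\<in>\<Union>S. 1 + (if v \<in> \<Union>A then 1 else 0))"
  proof -
    have "\<Union>S \<inter> \<Union>A = \<Union>A"
      using assms by blast
    then show ?thesis
      using fin by (simp only: sum.distrib sum.inter_restrict[symmetric]) simp
  qed
  also have "\<dots> \<le> (\<Sum>v\<in>\<Union>S. card {e \<in> S. v \<in> e})"
  proof (rule sum_mono)
    fix v assume "v \<in> \<Union>S"
    \<comment> \<open>If \<open>v\<close> lies in \<open>\<Union>A\<close>, then \<open>e\<close> is
      taken from \<open>A\<close>, so that its cover supplies a second edge through
      \<open>v\<close>.\<close>
    then obtain e where e: "e \<in> S" "v \<in> e" "v \<in> \<Union>A \<longrightarrow> e \<in> A"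
      using assms(2) by blast
    show "1 + (if v \<in> \<Union>A then 1 else 0) \<le> card {e \<in> S. v \<in> e}"
    proof (cases "v \<in> \<Union>A")
      case True
      then obtain f where "f \<in> S" "v \<in> f" "f \<noteq> e"
        using e assms(4) by blast
      then have "card {e, f} \<le> card {e \<in> S. v \<in> e}"
        using e assms(1) by (intro card_mono) auto
      then show ?thesis
        using \<open>f \<noteq> e\<close> by simp
    next
      case False
      have "card {e} \<le> card {e \<in> S. v \<in> e}"
        using e assms(1) by (intro card_mono) auto
      then show ?thesis
        using False by simp
    qed
  qed
  also have "\<dots> = (\<Sum>e\<in>S. card {v \<in> \<Union>S. v \<in> e})"
    by (rule sum_multicount_gen[OF assms(1) fin, symmetric]) simp
  also have "\<dots> = (\<Sum>e\<in>S. r)"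
  proof (rule sum.cong)
    fix e assume "e \<in> S"
    then have "{v \<in> \<Union>S. v \<in> e} = e"
      by blast
    then show "card {v \<in> \<Union>S. v \<in> e} = r"
      using assms(3) \<open>e \<in> S\<close> by simp
  qed simp
  finally show ?thesis by simp
qed

lemma locally_thin_if_sparse:
  assumes unif: "\<And>e. e \<in> F \<Longrightarrow> finite e \<and> card e = D * q"
    and s: "0 < s" "t \<le> s" "D * (s - t + 1) + 2 = s + (s - t + 1)"
    and sparse: "\<And>S. S \<subseteq> F \<Longrightarrow> card S \<in> {s, s - t + 1} \<Longrightarrow>
      card S * (D * q) < card (\<Union>S) + (card S - 1) * q"
  shows "locally_thin s t F"
  unfolding locally_thin_iff[OF s(1,2)]
proof (intro allI impI)
  fix S assume S: "S \<subseteq> F" "card S = s"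
  show "card {e \<in> S. e \<subseteq> \<Union>(S - {e})} \<le> s - t"
  proof (rule ccontr)
    assume "\<not> ?thesis"
    then have "s - t + 1 \<le> card {e \<in> S. e \<subseteq> \<Union>(S - {e})}"
      by linarith
    then obtain A where A: "A \<subseteq> {e \<in> S. e \<subseteq> \<Union>(S - {e})}" "card A = s - t + 1"
      by (rule obtain_subset_with_card_n)
    let ?k = "s - t + 1"
    have "finite S"
      using S s by (simp add: card_ge_0_finite)
    then have "card (\<Union>S) + card (\<Union>A) \<le> s * (D * q)"
      using card_Union_covered[of S A "D * q"] A(1) S unif by blast
    moreover have "s * (D * q) < card (\<Union>S) + (s - 1) * q"
      using sparse[of S] S by simp
    moreover have "?k * (D * q) < card (\<Union>A) + (?k - 1) * q"
      using sparse[of A] S A by (metis (no_types, lifting) insertCI mem_Collect_eq subset_iff)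
    \<comment> \<open>The equation for \<open>D\<close> makes the two losses
      \<open>(s - 1) * q\<close> and \<open>(?k - 1) * q\<close> add up exactly to
      \<open>?k * (D * q)\<close>, so the strict sparseness bounds contradict the double
      count.\<close>
    moreover have "?k * (D * q) = (s - 1) * q + (?k - 1) * q"
    proof -
      have "?k * D = (s - 1) + (?k - 1)"
        using s by (simp add: mult.commute)
      then show ?thesis
        by (metis add_mult_distrib mult.assoc)
    qed
    ultimately show False
      by linarith
  qed
qed

section \<open>Random subsets and sparse hypergraphs\<close>

text \<open>Divided by \<open>N choose m\<close>, the left side is the probability that a random
  \<open>m\<close>-subset contains a given \<open>j\<close>-set: a product of factors
  \<open>(m - i) / (N - i)\<close>, each at most \<open>m / N\<close>.\<close>

lemma binomial_diff_le:
  assumes "m \<le> N"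
  shows "j \<le> m \<Longrightarrow> real ((N - j) choose (m - j)) \<le> (real m / real N) ^ j * real (N choose m)"
proof (induction j)
  case (Suc j)
  let ?N = "N - j" and ?m = "m - j"
  have pos: "0 < ?m" "?m \<le> ?N"
    using Suc assms by auto
  have "?m * (?N choose ?m) = ?N * ((?N - 1) choose (?m - 1))"
    using pos times_binomial_minus1_eq by blast
  then have rec: "real ?m * real (?N choose ?m) = real ?N * real ((?N - 1) choose (?m - 1))"
    by (metis of_nat_mult)
  have "real ((N - Suc j) choose (m - Suc j)) = real ?m / real ?N * real (?N choose ?m)"
  proof -
    have "0 < real ?N"
      using pos by simp
    then have "real ((?N - 1) choose (?m - 1)) = real ?m / real ?N * real (?N choose ?m)"
      unfolding times_divide_eq_left rec by simp
    then show ?thesis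
      by simp
  qed
  also have "\<dots> \<le> real m / real N * real (?N choose ?m)"
  proof (rule mult_right_mono)
    have "real j * real m \<le> real j * real N"
      using assms by (simp add: mult_left_mono)
    then show "real ?m / real ?N \<le> real m / real N"
      using pos Suc.prems assms by (simp add: field_simps of_nat_diff)
  qed simp
  also have "\<dots> \<le> real m / real N * ((real m / real N) ^ j * real (N choose m))"
    using Suc by (intro mult_left_mono) auto
  finally show ?case
    by (simp add: mult.assoc)
qed simp

lemma card_supersets_of_card:
  assumes "finite R" "h \<subseteq> R" "card h \<le> m"
  shows "card {M. M \<subseteq> R \<and> card M = m \<and> h \<subseteq> M} = (card R - card h) choose (m - card h)"
proof -
  have fh: "finite h"
    using assms finite_subset by blast
  have "bij_betw (\<lambda>X. X \<union> h) {X. X \<subseteq> R - h \<and> card X = m - card h}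
      {M. M \<subseteq> R \<and> card M = m \<and> h \<subseteq> M}"
  proof (rule bij_betw_byWitness[where f' = "\<lambda>M. M - h"])
    show "(\<lambda>X. X \<union> h) ` {X. X \<subseteq> R - h \<and> card X = m - card h} \<subseteq> {M. M \<subseteq> R \<and> card M = m \<and> h \<subseteq> M}"
    proof (intro image_subsetI CollectI conjI)
      fix X assume X: "X \<in> {X. X \<subseteq> R - h \<and> card X = m - card h}"
      then have "finite X" "X \<inter> h = {}"
        using assms finite_subset by auto
      then show "card (X \<union> h) = m"
        using X fh assms by (simp add: card_Un_disjoint)
    qed (use assms in auto)
    show "(\<lambda>M. M - h) ` {M. M \<subseteq> R \<and> card M = m \<and> h \<subseteq> M} \<subseteq> {X. X \<subseteq> R - h \<and> card X = m - card h}"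
      using fh by (auto simp: card_Diff_subset)
  qed auto
  then have "card {M. M \<subseteq> R \<and> card M = m \<and> h \<subseteq> M} = card {X. X \<subseteq> R - h \<and> card X = m - card h}"
    by (simp add: bij_betw_same_card)
  also have "\<dots> = card (R - h) choose (m - card h)"
    using assms by (intro n_subsets) simp
  finally show ?thesis
    using assms fh by (simp add: card_Diff_subset)
qed

text \<open>Average over all \<open>m\<close>-subsets of \<open>R\<close>, then delete one point of each \<open>h\<close> that is left.\<close>

lemma deletion_method:
  assumes R: "finite R" and H: "\<And>h. h \<in> H \<Longrightarrow> h \<subseteq> R \<and> h \<noteq> {}" and m: "m \<le> card R"
    and few: "(\<Sum>h\<in>H. (real m / real (card R)) ^ card h) \<le> real m / 2"
  shows "\<exists>F\<subseteq>R. real m / 2 \<le> real (card F) \<and> (\<forall>h\<in>H. \<not> h \<subseteq> F)"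
proof -
  let ?MM = "{M. M \<subseteq> R \<and> card M = m}"
  have fMM: "finite ?MM" and cMM: "card ?MM = card R choose m"
    using R by (auto simp: n_subsets)
  have "H \<subseteq> Pow R"
    using H by blast
  then have fH: "finite H"
    using R by (meson finite_Pow_iff finite_subset)
  \<comment> \<open>Divided by \<open>card R choose m\<close>, both sides are the expected number of
    \<open>h\<close> inside a random \<open>m\<close>-subset.\<close>
  have "(\<Sum>M\<in>?MM. real (card {h \<in> H. h \<subseteq> M})) = (\<Sum>h\<in>H. real (card {M \<in> ?MM. h \<subseteq> M}))"
    using sum_multicount_gen[of ?MM H "\<lambda>M h. h \<subseteq> M" "\<lambda>h. card {M \<in> ?MM. h \<subseteq> M}"] fMM fH
    by (simp flip: of_nat_sum)
  also have "\<dots> \<le> (\<Sum>h\<in>H. (real m / real (card R)) ^ card h * real (card R choose m))"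
  proof (rule sum_mono)
    fix h assume h: "h \<in> H"
    show "real (card {M \<in> ?MM. h \<subseteq> M}) \<le> (real m / real (card R)) ^ card h * real (card R choose m)"
    proof (cases "card h \<le> m")
      case True
      have "{M \<in> ?MM. h \<subseteq> M} = {M. M \<subseteq> R \<and> card M = m \<and> h \<subseteq> M}"
        by blast
      then show ?thesis
        using card_supersets_of_card[OF R _ True] H[OF h] binomial_diff_le[OF m True] by simp
    next
      case False
      then have "{M \<in> ?MM. h \<subseteq> M} = {}"
        using R by (auto dest: card_mono[rotated] finite_subset)
      then show ?thesis
        by (simp only: card.empty) simp
    qed
  qed
  also have "\<dots> \<le> real m / 2 * real (card R choose m)"
    using mult_right_mono[OF few, of "real (card R choose m)"] by (simp flip: sum_distrib_right)
  finally have avg: "(\<Sum>M\<in>?MM. real (card {h \<in> H. h \<subseteq> M})) \<le> (\<Sum>M\<in>?MM. real m / 2)"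
    using cMM by (simp add: mult.commute)
  have "\<exists>M\<in>?MM. real (card {h \<in> H. h \<subseteq> M}) \<le> real m / 2"
  proof (rule ccontr)
    assume "\<not> ?thesis"
    moreover have "?MM \<noteq> {}"
      using cMM m by (metis card.empty binomial_eq_0_iff not_le)
    ultimately have "(\<Sum>M\<in>?MM. real m / 2) < (\<Sum>M\<in>?MM. real (card {h \<in> H. h \<subseteq> M}))"
      by (intro sum_strict_mono fMM) auto
    with avg show False by linarith
  qed
  then obtain M where M: "M \<subseteq> R" "card M = m" "real (card {h \<in> H. h \<subseteq> M}) \<le> real m / 2"
    by blast
  \<comment> \<open>One point from each surviving \<open>h\<close>: removing \<open>D\<close> costs
    at most \<open>m / 2\<close> elements and destroys all these sets.\<close>
  define D where "D = (\<lambda>h. SOME e. e \<in> h) ` {h \<in> H. h \<subseteq> M}"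
  have D: "(SOME e. e \<in> h) \<in> h" if "h \<in> H" for h
    using H[OF that] by (simp add: some_in_eq)
  have "card D \<le> card {h \<in> H. h \<subseteq> M}"
    unfolding D_def using fH by (intro card_image_le) simp
  moreover have "card M - card D \<le> card (M - D)"
    using fH by (intro diff_card_le_card_Diff) (simp add: D_def)
  ultimately have "real m / 2 \<le> real (card (M - D))"
    using M by linarith
  moreover have "\<not> h \<subseteq> M - D" if "h \<in> H" for h
    using D[OF that] that unfolding D_def by blast
  ultimately show ?thesis
    using M(1) by (intro exI[of _ "M - D"]) auto
qed

text \<open>The union of such a family fits into a \<open>w\<close>-subset \<open>W\<close> of
  \<open>V\<close>; at most \<open>card V ^ w\<close> sets \<open>W\<close> exist, each carrying
  \<open>2 ^ (w choose r)\<close> families of \<open>r\<close>-subsets.\<close>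

lemma card_families_small_union:
  assumes V: "finite V" "w \<le> card V"
  shows "card {h. h \<subseteq> {e. e \<subseteq> V \<and> card e = r} \<and> card h = j \<and> card (\<Union>h) \<le> w}
    \<le> card V ^ w * 2 ^ (w choose r)"
proof -
  let ?W = "{W. W \<subseteq> V \<and> card W = w}"
  have fin: "finite ?W"
    using V by simp
  have "{h. h \<subseteq> {e. e \<subseteq> V \<and> card e = r} \<and> card h = j \<and> card (\<Union>h) \<le> w}
      \<subseteq> (\<Union>W\<in>?W. Pow {e. e \<subseteq> W \<and> card e = r})"
  proof
    fix h assume h: "h \<in> {h. h \<subseteq> {e. e \<subseteq> V \<and> card e = r} \<and> card h = j \<and> card (\<Union>h) \<le> w}"
    then have "\<Union>h \<subseteq> V"
      by blast
    then obtain W where W: "\<Union>h \<subseteq> W" "W \<subseteq> V" "card W = w"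
      using exists_subset_between[of "\<Union>h" w V] h V by auto
    have "h \<in> Pow {e. e \<subseteq> W \<and> card e = r}"
      using h W(1) by blast
    then show "h \<in> (\<Union>W\<in>?W. Pow {e. e \<subseteq> W \<and> card e = r})"
      using W(2,3) by (intro UN_I) simp_all
  qed
  then have "card {h. h \<subseteq> {e. e \<subseteq> V \<and> card e = r} \<and> card h = j \<and> card (\<Union>h) \<le> w}
      \<le> card (\<Union>W\<in>?W. Pow {e. e \<subseteq> W \<and> card e = r})"
  proof (rule card_mono[rotated])
    have "finite W" if "W \<in> ?W" for W
      using that V(1) by (auto intro: finite_subset)
    then show "finite (\<Union>W\<in>?W. Pow {e. e \<subseteq> W \<and> card e = r})"
      using fin by simp
  qed
  also have "\<dots> \<le> (\<Sum>W\<in>?W. card (Pow {e. e \<subseteq> W \<and> card e = r}))"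
    by (rule card_UN_le[OF fin])
  also have "\<dots> = (\<Sum>W\<in>?W. 2 ^ (w choose r))"
  proof (rule sum.cong)
    fix W assume W: "W \<in> ?W"
    then have "finite W"
      using V finite_subset by blast
    then show "card (Pow {e. e \<subseteq> W \<and> card e = r}) = 2 ^ (w choose r)"
      using W by (simp add: card_Pow n_subsets)
  qed simp
  also have "\<dots> = (card V choose w) * 2 ^ (w choose r)"
    using V by (simp add: n_subsets)
  also have "\<dots> \<le> card V ^ w * 2 ^ (w choose r)"
    using binomial_le_pow[OF V(2)] by simp
  finally show ?thesis .
qed

text \<open>Bounds the expected number of bad \<open>j\<close>-families in a random
  \<open>m\<close>-subset. One factor \<open>m\<close> is kept and the other \<open>j - 1\<close>
  are replaced by \<open>c * n ^ q\<close>; this raises the power of \<open>n\<close> to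
  \<open>n ^ (j * r)\<close>, which \<open>(N * C) ^ j\<close> absorbs.\<close>

lemma expected_bad_le:
  fixes n m B C c N :: real
  assumes n: "0 < n" and m: "0 \<le> m" "m \<le> c * n ^ q" and c: "c \<le> 1"
    and B: "0 \<le> B" "B * C ^ j * c \<le> 1 / 4" and C: "0 < C" "n ^ r \<le> N * C"
    and q: "q \<le> r" and j: "2 \<le> j"
  shows "B * n ^ (j * r - (j - 1) * q) * (m / N) ^ j \<le> m / 4"
proof -
  obtain i where i: "j = Suc i" "1 \<le> i"
    using j by (cases j) auto
  have N: "0 < N"
    using n C by (metis zero_less_mult_pos2 order_less_le_trans zero_less_power)
  have "0 \<le> c * n ^ q"
    using m by linarith
  then have c0: "0 \<le> c"
    using n by (simp add: zero_le_mult_iff not_le) (meson not_le zero_less_power)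
  have "m ^ i \<le> (c * n ^ q) ^ i"
    using m by (intro power_mono) auto
  also have "\<dots> = c ^ i * n ^ (i * q)"
    by (simp add: power_mult_distrib mult.commute flip: power_mult)
  \<comment> \<open>\<open>2 \<le> j\<close> gives \<open>1 \<le> i\<close>, so at least one small
    factor \<open>c\<close> remains.\<close>
  also have "\<dots> \<le> c * n ^ (i * q)"
    using c c0 i power_decreasing[of 1 i c] n by (intro mult_right_mono) auto
  finally have mi: "m ^ i \<le> c * n ^ (i * q)" .
  \<comment> \<open>Hence the subtraction in the exponent does not truncate.\<close>
  have "i * q \<le> j * r"
    using i q by (simp add: mult_le_mono trans_le_add2)
  then have e: "n ^ (j * r - (j - 1) * q) * n ^ (i * q) = n ^ (j * r)"
    using i by (simp flip: power_add)
  have "B * n ^ (j * r - (j - 1) * q) * m ^ j = m * (B * n ^ (j * r - (j - 1) * q) * m ^ i)"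
    by (simp add: i)
  also have "\<dots> \<le> m * (B * n ^ (j * r - (j - 1) * q) * (c * n ^ (i * q)))"
    using n m B mi by (intro mult_left_mono) auto
  also have "\<dots> = m * (B * c * (n ^ r) ^ j)"
    by (simp add: mult.commute flip: e power_mult)
  also have "\<dots> \<le> m * (B * c * (N * C) ^ j)"
    using n m B c0 C by (intro mult_left_mono power_mono) auto
  also have "\<dots> = m * (B * C ^ j * c) * N ^ j"
    by (simp add: power_mult_distrib)
  also have "\<dots> \<le> m * (1 / 4) * N ^ j"
    using m B N by (intro mult_right_mono mult_left_mono) auto
  finally show ?thesis
    using N by (simp add: power_divide field_simps)
qed

text \<open>This is the lower bound of Brown, Erdos and Sos on sparse hypergraphs, for two sizes at once.\<close>

lemma ex_sparse_hypergraph: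
  fixes q r j1 j2 :: nat
  assumes q: "1 \<le> q" "q \<le> r" and J: "2 \<le> j1" "2 \<le> j2"
  shows "\<exists>c>0. \<forall>\<^sub>F n in sequentially. \<exists>F. uniform_hypergraph r {..<n} F \<and>
    c * real n ^ q \<le> real (card F) \<and>
    (\<forall>S\<subseteq>F. card S \<in> {j1, j2} \<longrightarrow> card S * r < card (\<Union>S) + (card S - 1) * q)"
proof -
  \<comment> \<open>A \<open>j\<close>-family is bad if it spans at most \<open>w j\<close>
    vertices. \<open>C\<close> compares \<open>n ^ r\<close> with \<open>n choose r\<close>, and
    \<open>B j\<close> counts the \<open>r\<close>-graphs on \<open>w j\<close> vertices.\<close>
  define w where "w j = j * r - (j - 1) * q" for j
  define C :: real where "C = real r ^ r"
  define B :: "nat \<Rightarrow> real" where "B j = 2 ^ (w j choose r)" for j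
  define K where "K j = B j * C ^ j" for j
  have C: "1 \<le> C" and B: "1 \<le> B j" and K: "1 \<le> K j" for j
  proof -
    show C: "1 \<le> C"
      using q unfolding C_def by simp
    show B: "1 \<le> B j"
      unfolding B_def by simp
    show "1 \<le> K j"
      unfolding K_def using B C by (metis mult_mono' mult_1 one_le_power zero_le_one)
  qed
  \<comment> \<open>Small enough for \<open>c * C \<le> 1\<close>, which yields
    \<open>m \<le> card R\<close>, and for \<open>K j * c \<le> 1 / 4\<close> at both sizes.\<close>
  define c where "c = 1 / (4 * (K j1 + K j2 + C))"
  have c0: "0 < c"
    unfolding c_def using K[of j1] K[of j2] C by simp
  have cC: "c * C \<le> 1" and cK1: "K j1 * c \<le> 1 / 4" and cK2: "K j2 * c \<le> 1 / 4" and c1: "c \<le> 1"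
    unfolding c_def using K[of j1] K[of j2] C by (simp_all add: field_simps)
  have "\<forall>\<^sub>F n in sequentially. \<exists>F. uniform_hypergraph r {..<n} F \<and>
    c / 4 * real n ^ q \<le> real (card F) \<and>
    (\<forall>S\<subseteq>F. card S \<in> {j1, j2} \<longrightarrow> card S * r < card (\<Union>S) + (card S - 1) * q)"
    \<comment> \<open>\<open>r \<le> n\<close> serves the binomial estimate,
      \<open>2 / c \<le> n\<close> the rounding in \<open>m\<close>, and \<open>w j \<le> n\<close>
      the count of bad families.\<close>
    using eventually_ge_at_top[of "max (max r (nat \<lceil>2 / c\<rceil>)) (max (w j1) (w j2))"]
  proof eventually_elim
    case (elim n)
    then have nr: "r \<le> n" and nc: "2 / c \<le> real n" and nw: "w j1 \<le> n" "w j2 \<le> n"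
      by (auto simp: nat_le_iff ceiling_le_iff)
    have n0: "1 \<le> n"
      using nr q by simp
    define R where "R = {e. e \<subseteq> {..<n} \<and> card e = r}"
    have fR: "finite R" and cR: "card R = n choose r"
      unfolding R_def by (simp_all add: n_subsets)
    have NC: "real n ^ r \<le> real (card R) * C"
    proof -
      have "(real n / real r) ^ r \<le> real (n choose r)"
        using binomial_ge_n_over_k_pow_k[OF nr, where 'a = real] by simp
      then show ?thesis
        using q unfolding cR C_def by (simp add: power_divide field_simps)
    qed
    define m where "m = nat \<lfloor>c * real n ^ q\<rfloor>"
    have m: "real m \<le> c * real n ^ q" "c * real n ^ q \<le> real m + 1"
      unfolding m_def using c0 by (simp_all add: zero_le_mult_iff less_imp_le)
    have "real m \<le> real (card R)"
    proof -
      have "real m * C \<le> c * real n ^ q * C"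
        using m C by (intro mult_right_mono) auto
      also have "\<dots> = (c * C) * real n ^ q"
        by simp
      also have "\<dots> \<le> real n ^ q"
        using mult_right_mono[OF cC, of "real n ^ q"] by simp
      also have "\<dots> \<le> real n ^ r"
        using n0 q by (intro power_increasing) auto
      also have "\<dots> \<le> real (card R) * C"
        by (rule NC)
      finally show ?thesis
        using C by simp
    qed
    then have mR: "m \<le> card R"
      by simp
    define H where "H j = {h. h \<subseteq> R \<and> card h = j \<and> card (\<Union>h) \<le> w j}" for j
    have fH: "finite (H j)" for j
      unfolding H_def using fR by simp
    have sumH: "(\<Sum>h\<in>H j. (real m / real (card R)) ^ card h) \<le> real m / 4"
      if "2 \<le> j" "w j \<le> n" "K j * c \<le> 1 / 4" for j
    proof -
      have "card (H j) \<le> n ^ w j * 2 ^ (w j choose r)"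
        using card_families_small_union[of "{..<n}" "w j" r j] that unfolding H_def R_def by simp
      then have "real (card (H j)) \<le> B j * real n ^ (j * r - (j - 1) * q)"
        unfolding B_def w_def[symmetric] by (simp add: mult.commute flip: of_nat_le_iff[where 'a = real])
      then have "(\<Sum>h\<in>H j. (real m / real (card R)) ^ card h)
          \<le> B j * real n ^ (j * r - (j - 1) * q) * (real m / real (card R)) ^ j"
        by (simp add: H_def mult_right_mono)
      also have "\<dots> \<le> real m / 4"
        by (rule expected_bad_le[where C = C and c = c])
          (use n0 m c1 that NC C q B[of j] in \<open>auto simp: K_def\<close>)
      finally show ?thesis .
    qed
    \<comment> \<open>Only an inequality, since \<open>H j1\<close> and \<open>H j2\<close> coincide
      if \<open>j1 = j2\<close>.\<close>
    have "(\<Sum>h\<in>H j1 \<union> H j2. (real m / real (card R)) ^ card h)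
        \<le> (\<Sum>h\<in>H j1. (real m / real (card R)) ^ card h)
          + (\<Sum>h\<in>H j2. (real m / real (card R)) ^ card h)"
      using sum_nonneg[of "H j1 \<inter> H j2" "\<lambda>h. (real m / real (card R)) ^ card h"]
      by (simp add: sum_Un[OF fH fH])
    also have "\<dots> \<le> real m / 2"
      using sumH[of j1] sumH[of j2] J nw cK1 cK2 by simp
    finally obtain F where F: "F \<subseteq> R" "real m / 2 \<le> real (card F)"
        "\<forall>h\<in>H j1 \<union> H j2. \<not> h \<subseteq> F"
      using deletion_method[OF fR _ mR, of "H j1 \<union> H j2"] J unfolding H_def by fastforce
    have "uniform_hypergraph r {..<n} F"
      using F(1) unfolding R_def uniform_hypergraph_def by auto
    moreover have "c / 4 * real n ^ q \<le> real (card F)"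
    proof -
      \<comment> \<open>Rounding then loses at most half of \<open>c * n ^ q\<close> and deletion
        half of the rest, whence \<open>c / 4\<close>.\<close>
      have "2 \<le> c * real n"
        using nc c0 by (simp add: field_simps)
      also have "\<dots> \<le> c * real n ^ q"
        using c0 n0 q self_le_power[of "real n" q] by (intro mult_left_mono) auto
      finally show ?thesis
        using m(2) F(2) by simp
    qed
    moreover have "card S * r < card (\<Union>S) + (card S - 1) * q"
      if "S \<subseteq> F" "card S \<in> {j1, j2}" for S
    proof -
      have "S \<notin> H (card S)"
        using F(3) that by blast
      then have "w (card S) < card (\<Union>S)"
        using F(1) that unfolding H_def by auto
      then show ?thesis
        unfolding w_def by linarith
    qed
    ultimately show ?case
      by blast
  qed
  then show ?thesis
    using c0 by (intro exI[of _ "c / 4"]) simp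
qed

section \<open>Asymptotics of the maximum\<close>

lemma max_thin_ge:
  assumes "uniform_hypergraph r {..<n} E" "locally_thin s t E"
  shows "card E \<le> max_thin s t n r"
  unfolding max_thin_def using assms finite_thin_sizes[of "{..<n}" r s t]
  by (intro Max_ge) auto

lemma max_thin_le:
  assumes "0 < s"
    and "\<And>E. uniform_hypergraph r {..<n} E \<Longrightarrow> locally_thin s t E \<Longrightarrow> card E \<le> b"
  shows "max_thin s t n r \<le> b"
  unfolding max_thin_def
  using assms finite_thin_sizes[of "{..<n}" r s t] thin_sizes_nonempty[of "{..<n}" s r t]
  by (subst Max_le_iff) auto

text \<open>The equation for \<open>D\<close> is the definition of \<open>d\<close>, cleared of
  denominators and of truncating subtraction.\<close>

lemma max_thin_bigtheta:
  fixes s t D q :: nat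
  assumes s: "t < s" "1 \<le> t" "D * (s - t + 1) + 2 = s + (s - t + 1)" and q: "1 \<le> q"
  shows "(\<lambda>n. real (max_thin s t n (D * q))) \<in> \<Theta>(\<lambda>n. real n ^ q)"
proof (rule bigthetaI)
  have D: "1 \<le> D"
    using s by (cases D) auto
  have upper: "max_thin s t n (D * q) \<le> (n choose q) + s" for n
  proof (rule max_thin_le)
    fix E assume E: "uniform_hypergraph (D * q) {..<n} E" "locally_thin s t E"
    show "card E \<le> (n choose q) + s"
    proof (cases "D = 1")
      \<comment> \<open>The covering argument requires \<open>1 \<le> c\<close>; for
        \<open>D = 1\<close> the edges are themselves \<open>q\<close>-sets.\<close>
      case True
      then have "card E \<le> card {e. e \<subseteq> {..<n} \<and> card e = q}"
        using E by (intro card_mono) (auto simp: uniform_hypergraph_def)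
      then show ?thesis
        by (simp add: n_subsets)
    next
      case False
      then obtain c where c: "D = Suc c" "1 \<le> c"
        using D by (cases D) auto
      then show ?thesis
        using locally_thin_card_le[of c q "{..<n}" E s t] E s by (simp add: mult.commute)
    qed
  qed (use s in simp)
  show "(\<lambda>n. real (max_thin s t n (D * q))) \<in> O(\<lambda>n. real n ^ q)"
  proof (rule bigoI[where c = "1 + real s"])
    show "\<forall>\<^sub>F n in sequentially.
        norm (real (max_thin s t n (D * q))) \<le> (1 + real s) * norm (real n ^ q)"
      using eventually_ge_at_top[of "max 1 q"]
    proof eventually_elim
      case (elim n)
      have "max_thin s t n (D * q) \<le> n ^ q + s * n ^ q"
      proof -
        have "n choose q \<le> n ^ q" "1 \<le> n ^ q"
          using elim by (simp_all add: binomial_le_pow)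
        then have "(n choose q) + s * 1 \<le> n ^ q + s * n ^ q"
          by (intro add_mono mult_le_mono2)
        then show ?thesis
          using upper[of n] by simp
      qed
      then have "real (max_thin s t n (D * q)) \<le> real (n ^ q + s * n ^ q)"
        by (simp only: of_nat_le_iff)
      then show ?case
        by (simp add: algebra_simps)
    qed
  qed
  obtain c where c: "c > 0" and ev: "\<forall>\<^sub>F n in sequentially.
      \<exists>F. uniform_hypergraph (D * q) {..<n} F \<and> c * real n ^ q \<le> real (card F) \<and>
      (\<forall>S\<subseteq>F. card S \<in> {s, s - t + 1} \<longrightarrow>
        card S * (D * q) < card (\<Union>S) + (card S - 1) * q)"
  proof -
    \<comment> \<open>Both sizes must be at least 2; for \<open>s - t + 1\<close> this is
      \<open>t < s\<close>.\<close>
    have "q \<le> D * q" "2 \<le> s" "2 \<le> s - t + 1"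
      using D s(1,2) by auto
    from ex_sparse_hypergraph[OF q this] show ?thesis
      using that by blast
  qed
  show "(\<lambda>n. real (max_thin s t n (D * q))) \<in> \<Omega>(\<lambda>n. real n ^ q)"
  proof (rule landau_omega.bigI[OF c])
    show "\<forall>\<^sub>F n in sequentially.
        c * norm (real n ^ q) \<le> norm (real (max_thin s t n (D * q)))"
      using ev
    proof eventually_elim
      case (elim n)
      then obtain F where F: "uniform_hypergraph (D * q) {..<n} F"
          "c * real n ^ q \<le> real (card F)"
          "\<And>S. S \<subseteq> F \<Longrightarrow> card S \<in> {s, s - t + 1} \<Longrightarrow>
            card S * (D * q) < card (\<Union>S) + (card S - 1) * q"
        by blast
      have "\<And>e. e \<in> F \<Longrightarrow> finite e \<and> card e = D * q"
        using F(1) finite_subset unfolding uniform_hypergraph_def by blast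
      then have "locally_thin s t F"
        using locally_thin_if_sparse[of F D q s t] s F(3) by simp
      then show ?case
        using max_thin_ge[OF F(1)] F(2) by force
    qed
  qed
qed

theorem corollary1p4:
  fixes s t r :: nat and d :: int
  assumes "s > t" and "t \<ge> 1" and "r \<ge> 2"
    and "real_of_int d = (2 * real s - real t - 1) / (real s - real t + 1)"
    and "d dvd int r"
  shows "(\<lambda>n. real (max_thin s t n r)) \<in> \<Theta>(\<lambda>n. real n powr (real r / real_of_int d))
    \<and> (\<lambda>n. real (max_thin s t n r)) \<in>
        \<Theta>(\<lambda>n. real n powr ((real s - real t + 1) * real r / (2 * real s - real t - 1)))"
proof -
  have k: "0 < real s - real t + 1" and num: "0 < 2 * real s - real t - 1"
    using assms(1,2) by linarith+
  have "0 < real_of_int d"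
    unfolding assms(4) using k num by simp
  then obtain D where D: "d = int D" "0 < D"
    by (metis of_int_0_less_iff pos_int_cases)
  obtain q where r: "r = D * q"
    using assms(5) unfolding D(1) int_dvd_int_iff by (elim dvdE)
  have q: "1 \<le> q"
    using assms(3) r by (cases q) auto
  have "real D * (real s - real t + 1) = 2 * real s - real t - 1"
    using assms(4) k D by (simp add: field_simps)
  \<comment> \<open>\<open>t < s\<close> lets the natural difference \<open>s - t\<close> be cast
    exactly.\<close>
  then have "real (D * (s - t + 1) + 2) = real (s + (s - t + 1))"
    using assms(1) by (simp only: of_nat_add of_nat_mult of_nat_diff less_imp_le) simp
  then have Dk: "D * (s - t + 1) + 2 = s + (s - t + 1)"
    by (simp only: of_nat_eq_iff)
  have e1: "real r / real_of_int d = real q"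
    using D r by simp
  have e2: "(real s - real t + 1) * real r / (2 * real s - real t - 1) = real r / real_of_int d"
    unfolding assms(4) using k num by (simp add: field_simps)
  have "(\<lambda>n. real n powr real q) \<in> \<Theta>(\<lambda>n. real n ^ q)"
    by (rule bigthetaI_cong, rule eventually_mono[OF eventually_gt_at_top[of 0]])
      (simp add: powr_realpow)
  then have "(\<lambda>n. real (max_thin s t n r)) \<in> \<Theta>(\<lambda>n. real n powr real q)"
    using max_thin_bigtheta[OF assms(1,2) Dk q] r landau_theta.trans bigtheta_sym by metis
  then show ?thesis
    unfolding e2 e1 by blast
qed

end
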